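(* Let $s\ge 2$ and $\eta>0$ be fixed, and consider the $s$-stage Chebyshev scheme of order one applied to the optimal control problem $\min_u \Psi(y(T))$, $\dot y=f(u,y)$, $y(0)=y^0$, i.e. minimize $\Psi(y_N)$ subject to $y_0=y^0$ and, for $k=0,\dots,N-1$, $$y_{k0}=y_k,\quad y_{k1}=y_{k0}+\mu_1hf(u_{k0},y_{k0}),$$ $$y_{ki}=\mu_ihf(u_{k,i-1},y_{k,i-1})+\nu_iy_{k,i-1}+(1-\nu_i)y_{k,i-2}\ (i=2,\dots,s),\quad y_{k+1}=y_{ks},$$ with the coefficients $\mu_i,\nu_i$ given in the context. Define $\alpha_s=1$, $\alpha_{s-1}=\nu_s$, and $\alpha_{s-j}=\nu_{s-j+1}\alpha_{s-j+1}+(1-\nu_{s-j+2})\alpha_{s-j+2}$ for $j=2,\dots,s-1$. Then the double adjoint of this scheme (see context) is given by the recurrence, for $k=N-1,\dots,1,0$, $$p_N=\nabla\Psi(y_N),\qquad p_{ks}=p_{k+1},$$ $$p_{k,s-1}=p_{ks}+\frac{\mu_s}{\nu_s}h\nabla_yH(u_{k,s-1},y_{k,s-1},p_{ks}),$$ $$p_{k,s-j}=\frac{\mu_{s-j+1}\alpha_{s-j+1}}{\alpha_{s-j}}h\nabla_yH(u_{k,s-j},y_{k,s-j},p_{k,s-j+1})+\frac{\nu_{s-j+1}\alpha_{s-j+1}}{\alpha_{s-j}}p_{k,s-j+1}+\frac{(1-\nu_{s-j+2})\alpha_{s-j+2}}{\alpha_{s-j}}p_{k,s-j+2},\quad j=2,\dots,s-1,$$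 $$p_{k0}=\mu_1\alpha_1h\nabla_yH(u_{k0},y_{k0},p_{k1})+\alpha_1p_{k1}+(1-\nu_2)\alpha_2p_{k2},\qquad p_k=p_{k0},$$ $$\nabla_uH(u_{k,s-j},y_{k,s-j},p_{k,s-j+1})=0,\quad j=1,\dots,s.$$
   Context: Setting: $T>0$, $N\in\mathbb N$, $h=T/N$, $y^0\in\mathbb R^n$; $f:\mathbb R^m\times\mathbb R^n\to\mathbb R^n$ and $\Psi:\mathbb R^n\to\mathbb R$ are $C^\infty$. The pseudo-Hamiltonian is $H(u,y,p)=p^Tf(u,y)$, so $\nabla_yH(u,y,p)=(\partial f/\partial y(u,y))^Tp$. Chebyshev coefficients: $T_j$ denotes the Chebyshev polynomial, $T_j(\cos\theta)=\cos(j\theta)$. Set $\omega_0=1+\eta/s^2$, $\omega_1=T_s(\omega_0)/T_s'(\omega_0)$, $\mu_1=\omega_1/\omega_0$, and for $i=2,\dots,s$: $\mu_i=2\omega_1T_{i-1}(\omega_0)/T_i(\omega_0)$, $\nu_i=2\omega_0T_{i-1}(\omega_0)/T_i(\omega_0)$. Double adjoint: a Runge-Kutta method with coefficients $(a_{ij},w_i)_{i,j=1,\dots,s}$ and all $w_i\ne0$ has as double adjoint the Runge-Kutta method with coefficients $(\tilde a_{ij},\tilde w_i)=\left(\frac{w_j}{w_i}a_{ji},\,w_i\right)$, applied to the costate equation backward in time. Concretely, a scheme whose stages $y_{k0},\dots,y_{k,s-1}$ are written in Runge-Kutta form $y_{k,i-1}=y_k+h\sum_{j=1}^sa_{ij}f(u_{k,j-1},y_{k,j-1})$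 ($i=1,\dots,s$), $y_{k+1}=y_k+h\sum_{i=1}^sw_if(u_{k,i-1},y_{k,i-1})$ has as double adjoint the costate discretization, for $k=N-1,\dots,0$, $$p_N=\nabla\Psi(y_N),\quad p_k=p_{k+1}+h\sum_{i=1}^sw_i\nabla_yH(u_{k,i-1},y_{k,i-1},p_{k,i}),$$ $$p_{k,i}=p_{k+1}+h\sum_{j=1}^s\frac{w_j}{w_i}a_{ji}\nabla_yH(u_{k,j-1},y_{k,j-1},p_{k,j}),\quad i=1,\dots,s,$$ coupled with the conditions $\nabla_uH(u_{k,i-1},y_{k,i-1},p_{k,i})=0$, $i=1,\dots,s$. (The costate stage associated with the state stage $y_{k,i-1}$ is labelled $p_{k,i}$.) "Is given by the recurrence" means that the recurrence produces exactly the same values $p_k$ and stages $p_{k,1},\dots,p_{k,s}$ as this double adjoint. *)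

theory Defs
  imports "HOL-Analysis.Analysis" "HOL-Computational_Algebra.Polynomial"
begin

text \<open>Class \<open>C\<^sup>k\<close> on the whole space: in finite dimension, \<open>f\<close> is \<open>C\<^bsup>k+1\<^esup>\<close> iff it is differentiable
  and all its directional derivatives are \<open>C\<^sup>k\<close>.\<close>

primrec Ck :: "nat \<Rightarrow> ('a::euclidean_space \<Rightarrow> 'b::real_normed_vector) \<Rightarrow> bool" where
  "Ck 0 f \<longleftrightarrow> continuous_on UNIV f"
| "Ck (Suc k) f \<longleftrightarrow> (\<forall>x. f differentiable (at x)) \<and>
     (\<forall>v. Ck k (\<lambda>x. frechet_derivative f (at x) v))"

definition smooth :: "('a::euclidean_space \<Rightarrow> 'b::real_normed_vector) \<Rightarrow> bool" where
  "smooth f \<longleftrightarrow> (\<forall>k. Ck k f)"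

definition gradient :: "('a::real_inner \<Rightarrow> real) \<Rightarrow> 'a \<Rightarrow> 'a" where
  "gradient g x = (THE D. GDERIV g x :> D)"

definition hamiltonian ::
  "('u \<times> 'y::real_inner \<Rightarrow> 'y) \<Rightarrow> 'u \<Rightarrow> 'y \<Rightarrow> 'y \<Rightarrow> real" where
  "hamiltonian f u y p = p \<bullet> f (u, y)"

definition grad_y_H ::
  "('u \<times> 'y::real_inner \<Rightarrow> 'y) \<Rightarrow> 'u \<Rightarrow> 'y \<Rightarrow> 'y \<Rightarrow> 'y" where
  "grad_y_H f u y p = gradient (\<lambda>z. hamiltonian f u z p) y"

definition grad_u_H ::
  "('u::real_inner \<times> 'y::real_inner \<Rightarrow> 'y) \<Rightarrow> 'u \<Rightarrow> 'y \<Rightarrow> 'y \<Rightarrow> 'u" where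
  "grad_u_H f u y p = gradient (\<lambda>v. hamiltonian f v y p) u"

definition cheb_poly :: "nat \<Rightarrow> real poly" where
  "cheb_poly j = (THE q. \<forall>\<theta>::real. poly q (cos \<theta>) = cos (real j * \<theta>))"

definition omega0 :: "nat \<Rightarrow> real \<Rightarrow> real" where
  "omega0 s \<eta> = 1 + \<eta> / real s ^ 2"

definition omega1 :: "nat \<Rightarrow> real \<Rightarrow> real" where
  "omega1 s \<eta> = poly (cheb_poly s) (omega0 s \<eta>) / poly (pderiv (cheb_poly s)) (omega0 s \<eta>)"

text \<open>\<open>cheb_mu s \<eta> i\<close> is meaningful for \<open>1 \<le> i \<le> s\<close>, and \<open>cheb_nu s \<eta> i\<close> for \<open>2 \<le> i \<le> s\<close>.\<close>

definition cheb_mu :: "nat \<Rightarrow> real \<Rightarrow> nat \<Rightarrow> real" where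
  "cheb_mu s \<eta> i = (if i = 1 then omega1 s \<eta> / omega0 s \<eta>
     else 2 * omega1 s \<eta> * poly (cheb_poly (i - 1)) (omega0 s \<eta>)
            / poly (cheb_poly i) (omega0 s \<eta>))"

definition cheb_nu :: "nat \<Rightarrow> real \<Rightarrow> nat \<Rightarrow> real" where
  "cheb_nu s \<eta> i = 2 * omega0 s \<eta> * poly (cheb_poly (i - 1)) (omega0 s \<eta>)
     / poly (cheb_poly i) (omega0 s \<eta>)"

text \<open>A scheme is a relation between the step size \<open>h\<close>, the vector field \<open>f\<close>, the stage
  controls \<open>U 0, \<dots>, U (s - 1)\<close>, the current state, the internal stages \<open>Y 0, Y 1, \<dots>\<close> and the
  next state.\<close>

type_synonym ('u, 'y) one_step =
  "real \<Rightarrow> ('u \<times> 'y \<Rightarrow> 'y) \<Rightarrow> (nat \<Rightarrow> 'u) \<Rightarrow> 'y \<Rightarrow> (nat \<Rightarrow> 'y) \<Rightarrow> 'y \<Rightarrow> bool"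

definition chebyshev_step :: "nat \<Rightarrow> real \<Rightarrow> ('u, 'y::real_vector) one_step" where
  "chebyshev_step s \<eta> h f U y Y y' \<longleftrightarrow>
     Y 0 = y \<and>
     Y 1 = Y 0 + (cheb_mu s \<eta> 1 * h) *\<^sub>R f (U 0, Y 0) \<and>
     (\<forall>i\<in>{2..s}. Y i = (cheb_mu s \<eta> i * h) *\<^sub>R f (U (i - 1), Y (i - 1))
        + cheb_nu s \<eta> i *\<^sub>R Y (i - 1) + (1 - cheb_nu s \<eta> i) *\<^sub>R Y (i - 2)) \<and>
     y' = Y s"

text \<open>The coefficients \<open>a i j\<close>, \<open>w i\<close> are indexed from \<open>1\<close> to \<open>s\<close>; the \<open>i\<close>-th Runge-Kutta stage
  is \<open>Y (i - 1)\<close>, with control \<open>U (i - 1)\<close>.\<close>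

definition rk_step ::
  "nat \<Rightarrow> (nat \<Rightarrow> nat \<Rightarrow> real) \<Rightarrow> (nat \<Rightarrow> real) \<Rightarrow> ('u, 'y::real_vector) one_step" where
  "rk_step s a w h f U y Y y' \<longleftrightarrow>
     (\<forall>i\<in>{1..s}. Y (i - 1) = y + h *\<^sub>R (\<Sum>j=1..s. a i j *\<^sub>R f (U (j - 1), Y (j - 1)))) \<and>
     y' = y + h *\<^sub>R (\<Sum>i=1..s. w i *\<^sub>R f (U (i - 1), Y (i - 1)))"

text \<open>\<open>(a, w)\<close> are the Runge-Kutta coefficients of the scheme. They belong to the method and not
  to a particular problem, hence the quantification over all smooth vector fields. The conjunct
  \<open>Y s = y'\<close> accounts for the extra label \<open>Y s\<close> of the next state, which is not a Runge-Kutta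
  stage.\<close>

definition has_rk_form ::
  "nat \<Rightarrow> ('u::euclidean_space, 'y::euclidean_space) one_step
     \<Rightarrow> (nat \<Rightarrow> nat \<Rightarrow> real) \<Rightarrow> (nat \<Rightarrow> real) \<Rightarrow> bool" where
  "has_rk_form s step a w \<longleftrightarrow>
     (\<forall>h f U y Y y'. h > 0 \<longrightarrow> smooth f \<longrightarrow>
        (step h f U y Y y' \<longleftrightarrow> rk_step s a w h f U y Y y' \<and> Y s = y'))"

definition trajectory ::
  "('u, 'y) one_step \<Rightarrow> nat \<Rightarrow> real \<Rightarrow> ('u \<times> 'y \<Rightarrow> 'y) \<Rightarrow> 'y
     \<Rightarrow> (nat \<Rightarrow> nat \<Rightarrow> 'u) \<Rightarrow> (nat \<Rightarrow> 'y) \<Rightarrow> (nat \<Rightarrow> nat \<Rightarrow> 'y) \<Rightarrow> bool" where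
  "trajectory step N h f y0 u y Y \<longleftrightarrow>
     y 0 = y0 \<and> (\<forall>k<N. step h f (u k) (y k) (Y k) (y (Suc k)))"

text \<open>\<open>P k i\<close> is the costate stage associated with the state stage \<open>Y k (i - 1)\<close>, for
  \<open>1 \<le> i \<le> s\<close>; the double adjoint does not constrain \<open>P k 0\<close>, which the recurrence uses as
  another name for \<open>p k\<close>.\<close>

definition double_adjoint_costate ::
  "nat \<Rightarrow> (nat \<Rightarrow> nat \<Rightarrow> real) \<Rightarrow> (nat \<Rightarrow> real) \<Rightarrow> nat \<Rightarrow> real
     \<Rightarrow> ('u \<times> 'y::real_inner \<Rightarrow> 'y) \<Rightarrow> ('y \<Rightarrow> real)
     \<Rightarrow> (nat \<Rightarrow> nat \<Rightarrow> 'u) \<Rightarrow> (nat \<Rightarrow> 'y) \<Rightarrow> (nat \<Rightarrow> nat \<Rightarrow> 'y)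
     \<Rightarrow> (nat \<Rightarrow> 'y) \<Rightarrow> (nat \<Rightarrow> nat \<Rightarrow> 'y) \<Rightarrow> bool" where
  "double_adjoint_costate s a w N h f \<Psi> u y Y p P \<longleftrightarrow>
     p N = gradient \<Psi> (y N) \<and>
     (\<forall>k<N.
        p k = p (Suc k)
          + h *\<^sub>R (\<Sum>i=1..s. w i *\<^sub>R grad_y_H f (u k (i - 1)) (Y k (i - 1)) (P k i)) \<and>
        (\<forall>i\<in>{1..s}. P k i = p (Suc k)
          + h *\<^sub>R (\<Sum>j=1..s. (w j / w i * a j i) *\<^sub>R
                grad_y_H f (u k (j - 1)) (Y k (j - 1)) (P k j))))"

definition double_adjoint_stationarity ::
  "nat \<Rightarrow> nat \<Rightarrow> ('u::real_inner \<times> 'y::real_inner \<Rightarrow> 'y)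
     \<Rightarrow> (nat \<Rightarrow> nat \<Rightarrow> 'u) \<Rightarrow> (nat \<Rightarrow> nat \<Rightarrow> 'y) \<Rightarrow> (nat \<Rightarrow> nat \<Rightarrow> 'y) \<Rightarrow> bool" where
  "double_adjoint_stationarity s N f u Y P \<longleftrightarrow>
     (\<forall>k<N. \<forall>i\<in>{1..s}. grad_u_H f (u k (i - 1)) (Y k (i - 1)) (P k i) = 0)"

definition is_alpha :: "nat \<Rightarrow> (nat \<Rightarrow> real) \<Rightarrow> (nat \<Rightarrow> real) \<Rightarrow> bool" where
  "is_alpha s \<nu> \<alpha> \<longleftrightarrow>
     \<alpha> s = 1 \<and> \<alpha> (s - 1) = \<nu> s \<and>
     (\<forall>j\<in>{2..s-1}. \<alpha> (s - j) = \<nu> (s - j + 1) * \<alpha> (s - j + 1)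
                          + (1 - \<nu> (s - j + 2)) * \<alpha> (s - j + 2))"

definition recurrence_costate ::
  "nat \<Rightarrow> (nat \<Rightarrow> real) \<Rightarrow> (nat \<Rightarrow> real) \<Rightarrow> (nat \<Rightarrow> real) \<Rightarrow> nat \<Rightarrow> real
     \<Rightarrow> ('u \<times> 'y::real_inner \<Rightarrow> 'y) \<Rightarrow> ('y \<Rightarrow> real)
     \<Rightarrow> (nat \<Rightarrow> nat \<Rightarrow> 'u) \<Rightarrow> (nat \<Rightarrow> 'y) \<Rightarrow> (nat \<Rightarrow> nat \<Rightarrow> 'y)
     \<Rightarrow> (nat \<Rightarrow> 'y) \<Rightarrow> (nat \<Rightarrow> nat \<Rightarrow> 'y) \<Rightarrow> bool" where
  "recurrence_costate s \<mu> \<nu> \<alpha> N h f \<Psi> u y Y p P \<longleftrightarrow>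
     p N = gradient \<Psi> (y N) \<and>
     (\<forall>k<N.
        P k s = p (Suc k) \<and>
        P k (s - 1) = P k s
          + (\<mu> s / \<nu> s * h) *\<^sub>R grad_y_H f (u k (s - 1)) (Y k (s - 1)) (P k s) \<and>
        (\<forall>j\<in>{2..s-1}. P k (s - j) =
            (\<mu> (s - j + 1) * \<alpha> (s - j + 1) / \<alpha> (s - j) * h) *\<^sub>R
              grad_y_H f (u k (s - j)) (Y k (s - j)) (P k (s - j + 1))
          + (\<nu> (s - j + 1) * \<alpha> (s - j + 1) / \<alpha> (s - j)) *\<^sub>R P k (s - j + 1)
          + ((1 - \<nu> (s - j + 2)) * \<alpha> (s - j + 2) / \<alpha> (s - j)) *\<^sub>R P k (s - j + 2)) \<and>
        P k 0 = (\<mu> 1 * \<alpha> 1 * h) *\<^sub>R grad_y_H f (u k 0) (Y k 0) (P k 1)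
          + \<alpha> 1 *\<^sub>R P k 1 + ((1 - \<nu> 2) * \<alpha> 2) *\<^sub>R P k 2 \<and>
        p k = P k 0)"

definition recurrence_stationarity ::
  "nat \<Rightarrow> nat \<Rightarrow> ('u::real_inner \<times> 'y::real_inner \<Rightarrow> 'y)
     \<Rightarrow> (nat \<Rightarrow> nat \<Rightarrow> 'u) \<Rightarrow> (nat \<Rightarrow> nat \<Rightarrow> 'y) \<Rightarrow> (nat \<Rightarrow> nat \<Rightarrow> 'y) \<Rightarrow> bool" where
  "recurrence_stationarity s N f u Y P \<longleftrightarrow>
     (\<forall>k<N. \<forall>j\<in>{1..s}. grad_u_H f (u k (s - j)) (Y k (s - j)) (P k (s - j + 1)) = 0)"

lemma cheb_poly_exists: "\<exists>q. \<forall>\<theta>::real. poly q (cos \<theta>) = cos (real j * \<theta>)"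
proof (induction j rule: less_induct)
  case (less j)
  consider "j = 0" | "j = 1" | i where "j = Suc (Suc i)"
    by (metis One_nat_def old.nat.exhaust)
  then show ?case
  proof cases
    case 1
    then show ?thesis by (intro exI[of _ 1]) auto
  next
    case 2
    then show ?thesis by (intro exI[of _ "[:0, 1:]"]) auto
  next
    case 3
    obtain q r where q: "\<And>\<theta>::real. poly q (cos \<theta>) = cos (real (Suc i) * \<theta>)"
      and r: "\<And>\<theta>::real. poly r (cos \<theta>) = cos (real i * \<theta>)"
      using less[of "Suc i"] less[of i] 3 by auto
    have "poly ([:0, 2:] * q - r) (cos \<theta>) = cos (real j * \<theta>)" for \<theta> :: real
    proof -
      have "cos (real j * \<theta>) = cos (real (Suc i) * \<theta> + \<theta>)"
        and "cos (real i * \<theta>) = cos (real (Suc i) * \<theta> - \<theta>)"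
        using 3 by (simp_all add: algebra_simps)
      then show ?thesis by (simp add: q r cos_add cos_diff del: of_nat_Suc)
    qed
    then show ?thesis by blast
  qed
qed

lemma cheb_poly_unique:
  assumes "\<And>\<theta>::real. poly q (cos \<theta>) = cos (real j * \<theta>)"
    and "\<And>\<theta>::real. poly r (cos \<theta>) = cos (real j * \<theta>)"
  shows "q = r"
proof (rule ccontr)
  assume "q \<noteq> r"
  then have "finite {x. poly (q - r) x = 0}" by (intro poly_roots_finite) simp
  moreover have "{-1..1} \<subseteq> {x. poly (q - r) x = 0}"
  proof
    fix x :: real assume "x \<in> {-1..1}"
    then have "cos (arccos x) = x" by simp
    then show "x \<in> {x. poly (q - r) x = 0}"
      using assms[of "arccos x"] by simp
  qed
  ultimately have "finite {-1..1::real}" by (rule rev_finite_subset)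
  then show False by (simp add: infinite_Icc)
qed

lemma poly_cheb_poly_cos: "poly (cheb_poly j) (cos \<theta>) = cos (real j * \<theta>)"
proof -
  have "\<exists>!q. \<forall>\<theta>::real. poly q (cos \<theta>) = cos (real j * \<theta>)"
    using cheb_poly_exists cheb_poly_unique by blast
  from theI'[OF this] show ?thesis unfolding cheb_poly_def by blast
qed

end

theory Submission
  imports Defs
begin

text \<open>
  With the convention \<open>\<nu>\<^sub>1 = 1\<close>, the scheme is the single three-term recurrence
  \<open>Y\<^sub>i = \<mu>\<^sub>i h F\<^sub>i + \<nu>\<^sub>i Y\<^bsub>i-1\<^esub> + (1 - \<nu>\<^sub>i) Y\<^bsub>i-2\<^esub>\<close> for \<open>1 \<le> i \<le> s\<close>. Let \<open>B\<^bsub>ij\<^esub>\<close> be its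
  discrete Green's function, the response of \<open>Y\<^sub>i\<close> to a unit perturbation inserted at position
  \<open>j\<close>. Superposition gives \<open>Y\<^sub>i = y + h \<Sum>\<^sub>j \<mu>\<^sub>j B\<^bsub>ij\<^esub> F\<^sub>j\<close>, so a Runge-Kutta form is
  \<open>a\<^bsub>ij\<^esub> = \<mu>\<^sub>j B\<^bsub>i-1,j\<^esub>\<close> and \<open>w\<^sub>j = \<mu>\<^sub>j B\<^bsub>sj\<^esub>\<close> (\<open>chebyshev_has_rk_form\<close>). No other coefficients
  are possible, because vector fields that depend on the control alone make the stages
  arbitrary combinations of freely chosen slopes (\<open>has_rk_form_unique\<close>).

  The point is that \<open>B\<close>, defined by a recurrence in its first index, satisfies the
  transposed recurrence in its second index (\<open>green_backward\<close>). With first index \<open>s\<close>, this is the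
  definition of \<open>\<alpha>\<close>, so \<open>\<alpha>\<^sub>j = B\<^bsub>sj\<^esub>\<close> and \<open>w\<^sub>j = \<mu>\<^sub>j \<alpha>\<^sub>j\<close>. The stages of the double adjoint then
  read \<open>\<alpha>\<^sub>i (P\<^sub>i - p) = h \<Sum>\<^sub>j w\<^sub>j B\<^bsub>j-1,i\<^esub> G\<^sub>j\<close>, where \<open>p\<close> is the costate at the right end point
  and \<open>G\<^sub>j = \<nabla>\<^sub>y H\<close> at stage \<open>j\<close>. The right-hand side solves the transposed recurrence with source
  \<open>h w\<^sub>j G\<^sub>j\<close>, and this solution is unique; hence the double adjoint holds iff
  \<open>\<alpha>\<^sub>i (P\<^sub>i - p)\<close> solves the same recurrence. The constant \<open>p\<close> drops out because \<open>\<alpha>\<close> solves the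
  homogeneous one, and what remains is the stated recurrence (\<open>adjoint_step_iff\<close>).

  The divisions are legitimate because the weights are positive: \<open>\<alpha>\<^sub>i / T\<^sub>i(\<omega>\<^sub>0)\<close> solves the
  Chebyshev recurrence \<open>q\<^sub>i = 2 \<omega>\<^sub>0 q\<^bsub>i+1\<^esub> - q\<^bsub>i+2\<^esub>\<close>, whose solutions starting from
  \<open>0 \<le> q\<^bsub>s+1\<^esub> < q\<^sub>s\<close> grow as \<open>i\<close> decreases, since \<open>\<omega>\<^sub>0 > 1\<close> (\<open>green_cheb_pos\<close>).
\<close>

section \<open>Chebyshev polynomials to the right of 1\<close>

lemma cheb_polyI:
  assumes "\<And>\<theta>::real. poly q (cos \<theta>) = cos (real j * \<theta>)"
  shows "cheb_poly j = q"
  using cheb_poly_unique[of "cheb_poly j" j q] assms poly_cheb_poly_cos by blast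

lemma cheb_poly_0: "cheb_poly 0 = 1"
  by (rule cheb_polyI) simp

lemma cheb_poly_1: "cheb_poly (Suc 0) = [:0, 1:]"
  by (rule cheb_polyI) simp

lemma cheb_poly_Suc_Suc:
  "cheb_poly (Suc (Suc j)) = [:0, 2:] * cheb_poly (Suc j) - cheb_poly j"
proof (rule cheb_polyI)
  fix \<theta> :: real
  have "cos (real (Suc (Suc j)) * \<theta>) = cos (real (Suc j) * \<theta> + \<theta>)"
    and "cos (real j * \<theta>) = cos (real (Suc j) * \<theta> - \<theta>)"
    by (simp_all add: algebra_simps)
  then show "poly ([:0, 2:] * cheb_poly (Suc j) - cheb_poly j) (cos \<theta>)
      = cos (real (Suc (Suc j)) * \<theta>)"
    by (simp add: poly_cheb_poly_cos cos_add cos_diff del: of_nat_Suc)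
qed

lemma poly_cheb_Suc_Suc:
  "poly (cheb_poly (Suc (Suc j))) x = 2 * x * poly (cheb_poly (Suc j)) x - poly (cheb_poly j) x"
  by (simp add: cheb_poly_Suc_Suc)

lemma poly_cheb_mono:
  assumes "x \<ge> 1"
  shows "1 \<le> poly (cheb_poly j) x \<and> poly (cheb_poly j) x \<le> poly (cheb_poly (Suc j)) x"
proof (induction j)
  case 0
  then show ?case using assms by (simp add: cheb_poly_0 cheb_poly_1)
next
  case (Suc j)
  have "1 * poly (cheb_poly (Suc j)) x \<le> x * poly (cheb_poly (Suc j)) x"
    using assms Suc by (intro mult_right_mono) auto
  moreover have "poly (cheb_poly (Suc (Suc j))) x
      = 2 * (x * poly (cheb_poly (Suc j)) x) - poly (cheb_poly j) x"
    by (simp add: poly_cheb_Suc_Suc)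
  ultimately show ?case using Suc by linarith
qed

lemma poly_cheb_pos: "x \<ge> 1 \<Longrightarrow> poly (cheb_poly j) x > 0"
  using poly_cheb_mono[of x j] by linarith

lemma poly_pderiv_cheb_mono:
  assumes "x \<ge> 1"
  shows "0 \<le> poly (pderiv (cheb_poly j)) x
    \<and> poly (pderiv (cheb_poly j)) x < poly (pderiv (cheb_poly (Suc j))) x"
proof (induction j)
  case 0
  then show ?case by (simp add: cheb_poly_0 cheb_poly_1 pderiv_pCons)
next
  case (Suc j)
  have "1 * poly (pderiv (cheb_poly (Suc j))) x \<le> x * poly (pderiv (cheb_poly (Suc j))) x"
    using assms Suc by (intro mult_right_mono) auto
  moreover have "poly (pderiv (cheb_poly (Suc (Suc j)))) x = 2 * poly (cheb_poly (Suc j)) x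
      + 2 * (x * poly (pderiv (cheb_poly (Suc j))) x) - poly (pderiv (cheb_poly j)) x"
    by (simp add: cheb_poly_Suc_Suc[of j] pderiv_mult pderiv_diff pderiv_pCons pderiv_smult)
  ultimately show ?case using Suc poly_cheb_pos[OF assms, of "Suc j"] by linarith
qed

lemma omega0_gt_1:
  assumes "s \<ge> 1" "\<eta> > 0"
  shows "omega0 s \<eta> > 1"
  using assms by (simp add: omega0_def)

lemma omega1_pos:
  assumes "s \<ge> 1" "\<eta> > 0"
  shows "omega1 s \<eta> > 0"
proof -
  have x: "omega0 s \<eta> \<ge> 1" using omega0_gt_1[OF assms] by simp
  from assms obtain r where "s = Suc r" by (cases s) auto
  then show ?thesis
    using poly_cheb_pos[OF x, of s] poly_pderiv_cheb_mono[OF x, of r] by (simp add: omega1_def)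
qed

lemma cheb_mu_pos:
  assumes "s \<ge> 1" "\<eta> > 0"
  shows "cheb_mu s \<eta> i > 0"
proof -
  have "omega0 s \<eta> > 1" by (rule omega0_gt_1[OF assms])
  then show ?thesis
    unfolding cheb_mu_def
    using omega1_pos[OF assms] poly_cheb_pos[of "omega0 s \<eta>"]
    by (auto intro!: divide_pos_pos mult_pos_pos)
qed

section \<open>The Green's function of the three-term recurrence\<close>

text \<open>At \<open>j = 0\<close> the term \<open>green \<nu> (j - 1) i\<close> is a dummy: it is multiplied by \<open>0\<close> when
  \<open>\<nu> 1 = 1\<close>.\<close>

fun green :: "(nat \<Rightarrow> real) \<Rightarrow> nat \<Rightarrow> nat \<Rightarrow> real" where
  "green \<nu> 0 i = of_bool (i = 0)"
| "green \<nu> (Suc j) i = of_bool (i = Suc j) + \<nu> (Suc j) * green \<nu> j i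
     + (1 - \<nu> (Suc j)) * green \<nu> (j - 1) i"

lemma green_above_diagonal: "j < i \<Longrightarrow> green \<nu> j i = 0"
  by (induction \<nu> j i rule: green.induct) auto

lemma green_diagonal: "green \<nu> j j = 1"
  by (cases j) (auto simp: green_above_diagonal)

text \<open>The coefficients \<open>\<nu>\<close> and \<open>1 - \<nu>\<close> add up to one, so constant sequences are
  transported unchanged.\<close>

lemma green_column_0: "green \<nu> j 0 = 1"
proof (induction j rule: less_induct)
  case (less j)
  show ?case
  proof (cases j)
    case (Suc r)
    then have "green \<nu> r 0 = 1" "green \<nu> (r - 1) 0 = 1" using less.IH by simp_all
    with Suc show ?thesis by simp
  qed simp
qed

text \<open>A perturbation at position \<open>i\<close> acts on later values only through its direct
  effects on positions \<open>i + 1\<close> and \<open>i + 2\<close>: this is the forward recurrence read in the transposed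
  direction.\<close>

lemma green_backward:
  assumes "\<nu> 1 = 1"
  shows "green \<nu> j i = of_bool (i = j) + \<nu> (Suc i) * green \<nu> j (Suc i)
    + (1 - \<nu> (Suc (Suc i))) * green \<nu> j (Suc (Suc i))"
proof (induction j arbitrary: i rule: less_induct)
  case (less j)
  show ?case
  proof (cases j)
    case 0
    then show ?thesis by simp
  next
    case (Suc r)
    note IH1 = less.IH[of r i] and IH2 = less.IH[of "r - 1" i]
    \<comment> \<open>The unit sources of the forward and of the backward expansion cancel.\<close>
    have src: "\<nu> (Suc r) * of_bool (i = r) + (1 - \<nu> (Suc r)) * of_bool (i = r - 1)
        = \<nu> (Suc i) * of_bool (Suc i = Suc r)
          + (1 - \<nu> (Suc (Suc i))) * of_bool (Suc (Suc i) = Suc r)"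
    proof (cases "r = 0")
      case True
      then show ?thesis using assms by (cases i) auto
    next
      case False
      then show ?thesis by (cases "i = r"; cases "Suc i = r") auto
    qed
    have "green \<nu> j i = of_bool (i = j)
        + \<nu> (Suc r) * (of_bool (i = r) + \<nu> (Suc i) * green \<nu> r (Suc i)
            + (1 - \<nu> (Suc (Suc i))) * green \<nu> r (Suc (Suc i)))
        + (1 - \<nu> (Suc r)) * (of_bool (i = r - 1) + \<nu> (Suc i) * green \<nu> (r - 1) (Suc i)
            + (1 - \<nu> (Suc (Suc i))) * green \<nu> (r - 1) (Suc (Suc i)))"
      using IH1 IH2 Suc by simp
    also have "\<dots> = of_bool (i = j)
        + (\<nu> (Suc r) * of_bool (i = r) + (1 - \<nu> (Suc r)) * of_bool (i = r - 1))
        + \<nu> (Suc i) * (\<nu> (Suc r) * green \<nu> r (Suc i)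
            + (1 - \<nu> (Suc r)) * green \<nu> (r - 1) (Suc i))
        + (1 - \<nu> (Suc (Suc i))) * (\<nu> (Suc r) * green \<nu> r (Suc (Suc i))
            + (1 - \<nu> (Suc r)) * green \<nu> (r - 1) (Suc (Suc i)))"
      by (simp only: ring_distribs mult_ac add_ac)
    also have "\<dots> = of_bool (i = j) + \<nu> (Suc i) * green \<nu> j (Suc i)
        + (1 - \<nu> (Suc (Suc i))) * green \<nu> j (Suc (Suc i))"
      unfolding src Suc green.simps by (simp only: ring_distribs mult_ac add_ac)
    finally show ?thesis .
  qed
qed

text \<open>The superposition principle.\<close>

lemma three_term_recurrence_iff_green:
  fixes Y F :: "nat \<Rightarrow> 'a::real_vector"
  shows "Y 0 = y \<and> (\<forall>i\<in>{1..s}. Y i = (\<mu> i * h) *\<^sub>R F i + \<nu> i *\<^sub>R Y (i - 1)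
             + (1 - \<nu> i) *\<^sub>R Y (i - 2))
    \<longleftrightarrow> (\<forall>i\<le>s. Y i = y + h *\<^sub>R (\<Sum>j=1..s. (\<mu> j * green \<nu> i j) *\<^sub>R F j))"
    (is "?rec \<longleftrightarrow> ?sol")
proof -
  define Z where "Z i = y + h *\<^sub>R (\<Sum>j=1..s. (\<mu> j * green \<nu> i j) *\<^sub>R F j)" for i
  have Z0: "Z 0 = y" by (simp add: Z_def)
  have Zrec: "Z (Suc r) = (\<mu> (Suc r) * h) *\<^sub>R F (Suc r) + \<nu> (Suc r) *\<^sub>R Z r
      + (1 - \<nu> (Suc r)) *\<^sub>R Z (r - 1)" if "Suc r \<le> s" for r
  proof -
    have "(\<Sum>j=1..s. (\<mu> j * green \<nu> (Suc r) j) *\<^sub>R F j)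
      = (\<Sum>j=1..s. (if j = Suc r then \<mu> j *\<^sub>R F j else 0)
          + \<nu> (Suc r) *\<^sub>R ((\<mu> j * green \<nu> r j) *\<^sub>R F j)
          + (1 - \<nu> (Suc r)) *\<^sub>R ((\<mu> j * green \<nu> (r - 1) j) *\<^sub>R F j))"
      by (intro sum.cong refl) (auto simp: algebra_simps)
    also have "\<dots> = \<mu> (Suc r) *\<^sub>R F (Suc r)
        + \<nu> (Suc r) *\<^sub>R (\<Sum>j=1..s. (\<mu> j * green \<nu> r j) *\<^sub>R F j)
        + (1 - \<nu> (Suc r)) *\<^sub>R (\<Sum>j=1..s. (\<mu> j * green \<nu> (r - 1) j) *\<^sub>R F j)"
      using that by (simp add: sum.distrib scaleR_sum_right)
    finally have eq: "(\<Sum>j=1..s. (\<mu> j * green \<nu> (Suc r) j) *\<^sub>R F j) = \<dots>" .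
    show ?thesis unfolding Z_def eq by (simp add: algebra_simps del: green.simps)
  qed
  show ?thesis
  proof
    assume rec: ?rec
    have "i \<le> s \<Longrightarrow> Y i = Z i" for i
    proof (induction i rule: less_induct)
      case (less i)
      show ?case
      proof (cases i)
        case (Suc r)
        have "Y (Suc r) = (\<mu> (Suc r) * h) *\<^sub>R F (Suc r) + \<nu> (Suc r) *\<^sub>R Y r
            + (1 - \<nu> (Suc r)) *\<^sub>R Y (r - 1)"
          using rec less.prems Suc by (auto dest!: bspec[of _ _ "Suc r"])
        then show ?thesis using less Suc Zrec[of r] by simp
      qed (use rec Z0 in simp)
    qed
    then show ?sol by (simp add: Z_def)
  next
    assume sol: ?sol
    then have YZ: "Y i = Z i" if "i \<le> s" for i using that by (simp add: Z_def)
    show ?rec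
    proof (intro conjI ballI)
      show "Y 0 = y" using YZ[of 0] Z0 by simp
    next
      fix i assume i: "i \<in> {1..s}"
      then obtain r where "i = Suc r" by (cases i) auto
      then show "Y i = (\<mu> i * h) *\<^sub>R F i + \<nu> i *\<^sub>R Y (i - 1) + (1 - \<nu> i) *\<^sub>R Y (i - 2)"
        using i YZ Zrec[of r] by simp
    qed
  qed
qed

text \<open>In row \<open>s\<close> the source of the transposed recurrence sits at \<open>s\<close>, so the recurrence
  that defines \<open>\<alpha>\<close> downwards from \<open>\<alpha> s = 1\<close> has this row as its only solution.\<close>

lemma is_alpha_eq_green:
  assumes \<alpha>: "is_alpha s \<nu> \<alpha>" and \<nu>1: "\<nu> 1 = 1" and s: "s \<ge> 2"
  shows "i \<in> {1..s} \<Longrightarrow> \<alpha> i = green \<nu> s i"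
proof (induction "s - i" arbitrary: i rule: less_induct)
  case less
  consider "i = s" | "Suc i = s" | "Suc (Suc i) \<le> s" using less.prems by fastforce
  then show ?case
  proof cases
    case 1
    then show ?thesis using \<alpha> by (simp add: is_alpha_def green_diagonal)
  next
    case 2
    then have "i = s - 1" by simp
    then have "\<alpha> i = \<nu> s" using \<alpha> by (simp add: is_alpha_def)
    also have "\<nu> s = green \<nu> s i"
      using green_backward[of \<nu> s i, OF \<nu>1] 2
      by (simp del: green.simps add: green_diagonal green_above_diagonal)
    finally show ?thesis .
  next
    case 3
    then have j: "s - i \<in> {2..s-1}" using less.prems by auto
    have idx: "s - (s - i) = i" "s - (s - i) + 1 = Suc i" "s - (s - i) + 2 = Suc (Suc i)"
      using 3 by auto
    have "\<alpha> i = \<nu> (Suc i) * \<alpha> (Suc i) + (1 - \<nu> (Suc (Suc i))) * \<alpha> (Suc (Suc i))"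
      using \<alpha> j unfolding is_alpha_def by (metis idx)
    also have "\<dots> = \<nu> (Suc i) * green \<nu> s (Suc i)
        + (1 - \<nu> (Suc (Suc i))) * green \<nu> s (Suc (Suc i))"
      using less.hyps[of "Suc i"] less.hyps[of "Suc (Suc i)"] 3 by (simp del: green.simps)
    also have "\<dots> = green \<nu> s i"
      using green_backward[of \<nu> s i, OF \<nu>1] 3 by (simp del: green.simps)
    finally show ?thesis .
  qed
qed

text \<open>Since \<open>1 - \<nu>\<^sub>i = - T\<^bsub>i-2\<^esub> / T\<^sub>i\<close>, dividing by \<open>T\<^sub>i\<close> turns the transposed recurrence into
  the Chebyshev recurrence itself.\<close>

lemma green_cheb_pos:
  fixes s :: nat and \<eta> :: real
  defines "\<nu> \<equiv> (cheb_nu s \<eta>)(1 := 1)"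
  assumes s: "s \<ge> 1" and \<eta>: "\<eta> > 0" and i: "1 \<le> i" "i \<le> s"
  shows "green \<nu> s i > 0"
proof -
  define x where "x = omega0 s \<eta>"
  define T where "T j = poly (cheb_poly j) x" for j
  define q where "q j = green \<nu> s j / T j" for j
  have x1: "x > 1" unfolding x_def by (rule omega0_gt_1[OF s \<eta>])
  then have T: "T j > 0" for j unfolding T_def by (intro poly_cheb_pos) simp
  have T2: "T (Suc (Suc j)) = 2 * x * T (Suc j) - T j" for j
    unfolding T_def by (rule poly_cheb_Suc_Suc)
  have q_rec: "q r = 2 * x * q (Suc r) - q (Suc (Suc r))" if r: "1 \<le> r" "r < s" for r
  proof -
    have n1: "\<nu> (Suc r) = 2 * x * T r / T (Suc r)"
      using r by (simp add: \<nu>_def cheb_nu_def T_def x_def)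
    have "1 - \<nu> (Suc (Suc r)) = (T (Suc (Suc r)) - 2 * x * T (Suc r)) / T (Suc (Suc r))"
      using T[of "Suc (Suc r)"] by (simp add: \<nu>_def cheb_nu_def T_def x_def diff_divide_distrib)
    then have n2: "1 - \<nu> (Suc (Suc r)) = - T r / T (Suc (Suc r))" unfolding T2 by simp
    have "green \<nu> s r = \<nu> (Suc r) * green \<nu> s (Suc r)
        + (1 - \<nu> (Suc (Suc r))) * green \<nu> s (Suc (Suc r))"
      using green_backward[of \<nu> s r] r by (simp add: \<nu>_def del: green.simps)
    also have "\<dots> = T r * (2 * x * q (Suc r) - q (Suc (Suc r)))"
      unfolding n1 n2 q_def by (simp add: field_simps)
    finally show ?thesis using T[of r] by (simp add: q_def)
  qed
  have "q i > 0 \<and> q i \<ge> q (Suc i)"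
    using i(2)
  proof (induction rule: inc_induct)
    case base
    show ?case using T[of s] by (simp add: q_def green_diagonal green_above_diagonal)
  next
    case (step r)
    have "1 * q (Suc r) \<le> x * q (Suc r)"
      using x1 step.IH by (intro mult_right_mono) auto
    then show ?case using step i(1) q_rec[of r] by linarith
  qed
  then show ?thesis using T[of i] by (simp add: q_def zero_less_divide_iff)
qed

section \<open>Runge-Kutta forms\<close>

lemma Ck_const: "Ck k (\<lambda>x. c)"
  by (induction k arbitrary: c) auto

lemma smooth_bounded_linear:
  fixes f :: "'a::euclidean_space \<Rightarrow> 'b::real_normed_vector"
  assumes "bounded_linear f"
  shows "smooth f"
  unfolding smooth_def
proof
  fix k
  have d: "(f has_derivative f) (at x)" for x
    using bounded_linear_imp_has_derivative[OF assms] .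
  then have "frechet_derivative f (at x) = f" for x
    by (metis frechet_derivative_at)
  with d show "Ck k f"
    using assms by (cases k)
      (auto simp: Ck_const linear_continuous_on differentiable_def)
qed

text \<open>A vector field that is linear in the control and independent of the state makes every
  Runge-Kutta step explicit, and the stage controls can be chosen such that exactly one slope is
  nonzero. The stages then display one column of the tableau.\<close>

lemma has_rk_form_unique:
  fixes step :: "('u::euclidean_space, 'y::euclidean_space) one_step"
  assumes "has_rk_form s step a w" and "has_rk_form s step a' w'" and j: "j \<in> {1..s}"
  shows "w j = w' j" and "i \<in> {1..s} \<Longrightarrow> a i j = a' i j"
proof -
  obtain e :: 'u and d :: 'y where e: "e \<in> Basis" and d: "d \<in> Basis"
    by (rule that[OF SOME_Basis SOME_Basis])
  define f :: "'u \<times> 'y \<Rightarrow> 'y" where "f z = (fst z \<bullet> e) *\<^sub>R d" for z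
  define U where "U l = (if l = j - 1 then e else 0)" for l
  define Y where "Y l = (if l = s then w j else a (Suc l) j) *\<^sub>R d" for l
  have "smooth f"
    unfolding f_def
    by (intro smooth_bounded_linear bounded_linear_scaleR_left
        bounded_linear_compose[OF bounded_linear_scaleR_left]
        bounded_linear_compose[OF bounded_linear_inner_left] bounded_linear_fst)
  then have eq: "rk_step s a w 1 f U 0 Y (Y s) \<longleftrightarrow> rk_step s a' w' 1 f U 0 Y (Y s)"
    using assms(1,2) unfolding has_rk_form_def by (metis zero_less_one)
  have slope: "f (U (l - 1), v) = (if l = j then d else 0)" if "l \<in> {1..s}" for l v
    using that j e by (auto simp: f_def U_def)
  have sum: "(\<Sum>l=1..s. c l *\<^sub>R f (U (l - 1), Y (l - 1))) = c j *\<^sub>R d" for c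
  proof -
    have "(\<Sum>l=1..s. c l *\<^sub>R f (U (l - 1), Y (l - 1))) = (\<Sum>l=1..s. if l = j then c l *\<^sub>R d else 0)"
      by (intro sum.cong refl) (simp add: slope del: One_nat_def)
    also have "\<dots> = c j *\<^sub>R d" using j by simp
    finally show ?thesis .
  qed
  have "rk_step s a w 1 f U 0 Y (Y s)"
    unfolding rk_step_def sum by (auto simp: Y_def)
  with eq have "rk_step s a' w' 1 f U 0 Y (Y s)" by simp
  then have *: "\<forall>i\<in>{1..s}. Y (i - 1) = a' i j *\<^sub>R d" "Y s = w' j *\<^sub>R d"
    unfolding rk_step_def sum by simp_all
  have "d \<noteq> 0" using d by auto
  then show "w j = w' j" using *(2) by (simp add: Y_def)
  show "a i j = a' i j" if i: "i \<in> {1..s}"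
  proof -
    have "i - 1 \<noteq> s" "Suc (i - 1) = i" using i by auto
    then show ?thesis using bspec[OF *(1) i] \<open>d \<noteq> 0\<close> by (simp add: Y_def)
  qed
qed

lemma chebyshev_has_rk_form:
  fixes s :: nat and \<eta> :: real
  defines "\<nu> \<equiv> (cheb_nu s \<eta>)(1 := 1)"
  assumes s: "s \<ge> 1"
  shows "has_rk_form s (chebyshev_step s \<eta> :: ('u::euclidean_space, 'y::euclidean_space) one_step)
    (\<lambda>i j. cheb_mu s \<eta> j * green \<nu> (i - 1) j) (\<lambda>j. cheb_mu s \<eta> j * green \<nu> s j)"
  unfolding has_rk_form_def
proof (intro allI impI)
  fix h :: real and f :: "'u \<times> 'y \<Rightarrow> 'y" and U :: "nat \<Rightarrow> 'u" and y y' :: 'y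
    and Y :: "nat \<Rightarrow> 'y"
  define F where "F j = f (U (j - 1), Y (j - 1))" for j
  have nat_split: "(\<forall>i\<in>{1..s}. Q i) \<longleftrightarrow> Q 1 \<and> (\<forall>i\<in>{2..s}. Q i)" for Q :: "nat \<Rightarrow> bool"
  proof -
    have "{1..s} = insert 1 {2..s}" using s by auto
    then show ?thesis by simp
  qed
  have "chebyshev_step s \<eta> h f U y Y y' \<longleftrightarrow>
      (Y 0 = y \<and> (\<forall>i\<in>{1..s}. Y i = (cheb_mu s \<eta> i * h) *\<^sub>R F i + \<nu> i *\<^sub>R Y (i - 1)
        + (1 - \<nu> i) *\<^sub>R Y (i - 2))) \<and> y' = Y s"
    unfolding chebyshev_step_def nat_split by (auto simp: \<nu>_def F_def add.commute)
  also have "\<dots> \<longleftrightarrow>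
      (\<forall>i\<le>s. Y i = y + h *\<^sub>R (\<Sum>j=1..s. (cheb_mu s \<eta> j * green \<nu> i j) *\<^sub>R F j)) \<and> y' = Y s"
    unfolding three_term_recurrence_iff_green ..
  also have "\<dots> \<longleftrightarrow> rk_step s (\<lambda>i j. cheb_mu s \<eta> j * green \<nu> (i - 1) j)
      (\<lambda>j. cheb_mu s \<eta> j * green \<nu> s j) h f U y Y y' \<and> Y s = y'"
  proof -
    have "(\<forall>i\<le>s. Q i) \<longleftrightarrow> (\<forall>i\<in>{1..s}. Q (i - 1)) \<and> Q s" for Q :: "nat \<Rightarrow> bool"
    proof (intro iffI conjI ballI allI impI)
      fix i assume *: "(\<forall>i\<in>{1..s}. Q (i - 1)) \<and> Q s" and "i \<le> s"
      then show "Q i" by (cases "i = s") (auto dest!: bspec[of _ _ "Suc i"])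
    qed auto
    then show ?thesis unfolding rk_step_def F_def by auto
  qed
  finally show "chebyshev_step s \<eta> h f U y Y y' \<longleftrightarrow>
      rk_step s (\<lambda>i j. cheb_mu s \<eta> j * green \<nu> (i - 1) j)
        (\<lambda>j. cheb_mu s \<eta> j * green \<nu> s j) h f U y Y y' \<and> Y s = y'" .
qed

section \<open>The double adjoint of one step\<close>

lemma backward_recurrence_unique:
  fixes R S b :: "nat \<Rightarrow> 'a::real_vector"
  assumes end0: "R (Suc s) = 0" "S (Suc s) = 0" "S s = 0"
    and S: "\<And>i. i < s \<Longrightarrow> S i = b i + c i *\<^sub>R S (Suc i) + d i *\<^sub>R S (Suc (Suc i))"
  shows "(\<forall>i\<le>s. R i = S i) \<longleftrightarrow>
    R s = 0 \<and> (\<forall>i<s. R i = b i + c i *\<^sub>R R (Suc i) + d i *\<^sub>R R (Suc (Suc i)))"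
proof
  assume RS: "\<forall>i\<le>s. R i = S i"
  then have "R i = S i" if "i \<le> Suc s" for i
    using that end0 by (cases "i = Suc s") auto
  then show "R s = 0 \<and> (\<forall>i<s. R i = b i + c i *\<^sub>R R (Suc i) + d i *\<^sub>R R (Suc (Suc i)))"
    using S end0 by auto
next
  assume *: "R s = 0 \<and> (\<forall>i<s. R i = b i + c i *\<^sub>R R (Suc i) + d i *\<^sub>R R (Suc (Suc i)))"
  have "R i = S i \<and> R (Suc i) = S (Suc i)" if "i \<le> s" for i
    using that by (induction rule: inc_induct) (use * S end0 in auto)
  then show "\<forall>i\<le>s. R i = S i" by blast
qed

text \<open>The adjoint sums inherit the transposed recurrence from the columns of the Green's
  function; the unit source of column \<open>i\<close> picks out the term of stage \<open>i + 1\<close>.\<close>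

lemma adjoint_sum_backward:
  fixes G :: "nat \<Rightarrow> 'a::real_vector" and w :: "nat \<Rightarrow> real" and h :: real
  assumes \<nu>1: "\<nu> 1 = 1" and i: "i < s"
  defines "S \<equiv> \<lambda>i. h *\<^sub>R (\<Sum>j=1..s. (w j * green \<nu> (j - 1) i) *\<^sub>R G j)"
  shows "S i = (h * w (Suc i)) *\<^sub>R G (Suc i) + \<nu> (Suc i) *\<^sub>R S (Suc i)
    + (1 - \<nu> (Suc (Suc i))) *\<^sub>R S (Suc (Suc i))"
proof -
  have "(\<Sum>j=1..s. (w j * green \<nu> (j - 1) i) *\<^sub>R G j)
    = (\<Sum>j=1..s. (if j = Suc i then w j *\<^sub>R G j else 0)
        + \<nu> (Suc i) *\<^sub>R ((w j * green \<nu> (j - 1) (Suc i)) *\<^sub>R G j)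
        + (1 - \<nu> (Suc (Suc i))) *\<^sub>R ((w j * green \<nu> (j - 1) (Suc (Suc i))) *\<^sub>R G j))"
  proof (intro sum.cong refl)
    fix j assume "j \<in> {1..s}"
    then have "i = j - 1 \<longleftrightarrow> j = Suc i" by auto
    then show "(w j * green \<nu> (j - 1) i) *\<^sub>R G j
      = (if j = Suc i then w j *\<^sub>R G j else 0)
        + \<nu> (Suc i) *\<^sub>R ((w j * green \<nu> (j - 1) (Suc i)) *\<^sub>R G j)
        + (1 - \<nu> (Suc (Suc i))) *\<^sub>R ((w j * green \<nu> (j - 1) (Suc (Suc i))) *\<^sub>R G j)"
      by (subst green_backward[of \<nu> "j - 1" i, OF \<nu>1]) (auto simp: algebra_simps simp del: green.simps)
  qed
  also have "\<dots> = w (Suc i) *\<^sub>R G (Suc i)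
      + \<nu> (Suc i) *\<^sub>R (\<Sum>j=1..s. (w j * green \<nu> (j - 1) (Suc i)) *\<^sub>R G j)
      + (1 - \<nu> (Suc (Suc i)))
        *\<^sub>R (\<Sum>j=1..s. (w j * green \<nu> (j - 1) (Suc (Suc i))) *\<^sub>R G j)"
    using i by (simp add: sum.distrib scaleR_sum_right del: green.simps)
  finally have eq: "(\<Sum>j=1..s. (w j * green \<nu> (j - 1) i) *\<^sub>R G j) = \<dots>" .
  show ?thesis
    unfolding S_def eq by (simp add: scaleR_add_right mult.commute del: green.simps)
qed

text \<open>Both systems say that \<open>\<beta> i (P i - p')\<close>, where \<open>\<beta>\<close> is row \<open>s\<close> of the Green's function,
  equals the adjoint sum at every \<open>i \<le> s\<close>. The gradients \<open>G j\<close> may depend on the stages: they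
  are compared for the same \<open>P\<close>. At position \<open>0\<close>, where \<open>\<beta> 0 = 1\<close>, the adjoint sum is the quadrature
  sum of the update of the costate.\<close>

lemma adjoint_step_iff:
  fixes P G :: "nat \<Rightarrow> 'a::real_vector"
  assumes \<nu>1: "\<nu> 1 = 1" and \<mu>: "\<And>i. i \<in> {1..s} \<Longrightarrow> \<mu> i \<noteq> 0"
    and \<beta>0: "\<And>i. i \<in> {1..s} \<Longrightarrow> green \<nu> s i \<noteq> 0"
  defines "\<beta> \<equiv> green \<nu> s"
  defines "w \<equiv> \<lambda>i. \<mu> i * \<beta> i"
  shows "P 0 = p' + h *\<^sub>R (\<Sum>j=1..s. w j *\<^sub>R G j) \<and>
      (\<forall>i\<in>{1..s}. P i = p' + h *\<^sub>R (\<Sum>j=1..s. (w j / w i * (\<mu> i * green \<nu> (j - 1) i)) *\<^sub>R G j))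
    \<longleftrightarrow> P s = p' \<and> (\<forall>i<s. \<beta> i *\<^sub>R P i = (\<mu> (Suc i) * \<beta> (Suc i) * h) *\<^sub>R G (Suc i)
      + (\<nu> (Suc i) * \<beta> (Suc i)) *\<^sub>R P (Suc i)
      + ((1 - \<nu> (Suc (Suc i))) * \<beta> (Suc (Suc i))) *\<^sub>R P (Suc (Suc i)))"
    (is "?adj \<longleftrightarrow> ?rec")
proof -
  define S where "S i = h *\<^sub>R (\<Sum>j=1..s. (w j * green \<nu> (j - 1) i) *\<^sub>R G j)" for i
  define R where "R i = \<beta> i *\<^sub>R (P i - p')" for i
  have col0: "\<beta> 0 = 1" unfolding \<beta>_def by (rule green_column_0)
  have \<beta>s: "\<beta> s = 1" unfolding \<beta>_def by (rule green_diagonal)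
  have nz: "\<beta> i \<noteq> 0" if "i \<le> s" for i
    using that \<beta>0[of i] col0 by (cases "i = 0") (auto simp: \<beta>_def simp del: green.simps)
  have stage: "(P i = p' + h *\<^sub>R (\<Sum>j=1..s. (w j / w i * (\<mu> i * green \<nu> (j - 1) i)) *\<^sub>R G j))
      \<longleftrightarrow> R i = S i" if i: "i \<in> {1..s}" for i
  proof -
    have "w j / w i * (\<mu> i * green \<nu> (j - 1) i) = inverse (\<beta> i) * (w j * green \<nu> (j - 1) i)" for j
      using \<mu>[OF i] nz[of i] i by (simp add: w_def field_simps)
    then have "h *\<^sub>R (\<Sum>j=1..s. (w j / w i * (\<mu> i * green \<nu> (j - 1) i)) *\<^sub>R G j)
        = inverse (\<beta> i) *\<^sub>R S i"
      unfolding S_def by (simp add: scaleR_sum_right mult_ac del: green.simps)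
    moreover have "P i = p' + inverse (\<beta> i) *\<^sub>R S i \<longleftrightarrow> R i = S i"
    proof -
      have "P i = p' + inverse (\<beta> i) *\<^sub>R S i \<longleftrightarrow> P i - p' = inverse (\<beta> i) *\<^sub>R S i"
        by (auto simp: algebra_simps)
      also have "\<dots> \<longleftrightarrow> \<beta> i *\<^sub>R (P i - p') = \<beta> i *\<^sub>R (inverse (\<beta> i) *\<^sub>R S i)"
        using nz[of i] i by (subst real_vector.scale_cancel_left) auto
      finally show ?thesis using nz[of i] i by (simp add: R_def)
    qed
    ultimately show ?thesis by (simp only:)
  qed
  have update: "P 0 = p' + h *\<^sub>R (\<Sum>j=1..s. w j *\<^sub>R G j) \<longleftrightarrow> R 0 = S 0"
    unfolding R_def S_def col0 green_column_0 by (auto simp: algebra_simps)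
  have "(\<forall>i\<le>s. R i = S i) \<longleftrightarrow> R 0 = S 0 \<and> (\<forall>i\<in>{1..s}. R i = S i)"
    by (metis One_nat_def Suc_leI atLeastAtMost_iff le0 not_gr_zero)
  then have "?adj \<longleftrightarrow> (\<forall>i\<le>s. R i = S i)"
    using stage update by simp
  also have "\<dots> \<longleftrightarrow> R s = 0 \<and> (\<forall>i<s. R i = (h * w (Suc i)) *\<^sub>R G (Suc i)
      + \<nu> (Suc i) *\<^sub>R R (Suc i) + (1 - \<nu> (Suc (Suc i))) *\<^sub>R R (Suc (Suc i)))"
  proof (rule backward_recurrence_unique)
    have "(\<Sum>j=1..s. (w j * green \<nu> (j - 1) i) *\<^sub>R G j) = 0" if "s \<le> i" for i
      using that by (intro sum.neutral) (auto simp: green_above_diagonal simp del: green.simps)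
    then have z: "S i = 0" if "s \<le> i" for i using that unfolding S_def by simp
    show "R (Suc s) = 0" by (simp add: R_def \<beta>_def green_above_diagonal del: green.simps)
    show "S (Suc s) = 0" "S s = 0" by (simp_all add: z)
    show "S i = (h * w (Suc i)) *\<^sub>R G (Suc i) + \<nu> (Suc i) *\<^sub>R S (Suc i)
        + (1 - \<nu> (Suc (Suc i))) *\<^sub>R S (Suc (Suc i))" if "i < s" for i
      unfolding S_def by (rule adjoint_sum_backward[where \<nu> = \<nu>, OF \<nu>1 that])
  qed
  also have "\<dots> \<longleftrightarrow> ?rec"
  proof -
    have "R i = (h * w (Suc i)) *\<^sub>R G (Suc i) + \<nu> (Suc i) *\<^sub>R R (Suc i)
          + (1 - \<nu> (Suc (Suc i))) *\<^sub>R R (Suc (Suc i))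
      \<longleftrightarrow> \<beta> i *\<^sub>R P i = (\<mu> (Suc i) * \<beta> (Suc i) * h) *\<^sub>R G (Suc i)
          + (\<nu> (Suc i) * \<beta> (Suc i)) *\<^sub>R P (Suc i)
          + ((1 - \<nu> (Suc (Suc i))) * \<beta> (Suc (Suc i))) *\<^sub>R P (Suc (Suc i))" if "i < s" for i
    proof -
      \<comment> \<open>The constant \<open>p'\<close> drops out: \<open>\<beta>\<close> solves the homogeneous recurrence.\<close>
      have p': "\<beta> i *\<^sub>R p' = (\<nu> (Suc i) * \<beta> (Suc i)) *\<^sub>R p'
          + ((1 - \<nu> (Suc (Suc i))) * \<beta> (Suc (Suc i))) *\<^sub>R p'"
        unfolding scaleR_add_left[symmetric]
        using green_backward[of \<nu> s i, OF \<nu>1] that by (simp add: \<beta>_def del: green.simps)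
      have shift: "x - (c\<^sub>1 + c\<^sub>2) = g + (q\<^sub>1 - c\<^sub>1) + (q\<^sub>2 - c\<^sub>2) \<longleftrightarrow> x = g + q\<^sub>1 + q\<^sub>2"
        for x g c\<^sub>1 c\<^sub>2 q\<^sub>1 q\<^sub>2 :: 'a
        by (auto simp: algebra_simps)
      show ?thesis
        unfolding R_def w_def scaleR_diff_right scaleR_scaleR p' shift
        by (simp only: mult.commute[of h])
    qed
    then show ?thesis by (simp add: R_def \<beta>s)
  qed
  finally show ?thesis .
qed

section \<open>The double adjoint of the Chebyshev scheme\<close>

theorem theorem3p3:
  fixes f :: "(real ^ 'm) \<times> (real ^ 'n) \<Rightarrow> real ^ 'n"
    and \<Psi> :: "real ^ 'n \<Rightarrow> real"
    and y0 :: "real ^ 'n"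
    and tf h \<eta> :: real
    and N s :: nat
    and \<alpha> :: "nat \<Rightarrow> real"
  assumes "tf > 0" and "N \<ge> 1" and "h = tf / real N"
    and "smooth f" and "smooth \<Psi>"
    and "s \<ge> 2" and "\<eta> > 0"
    and "is_alpha s (cheb_nu s \<eta>) \<alpha>"
  shows "(\<exists>a w. has_rk_form s (chebyshev_step s \<eta> :: (real ^ 'm, real ^ 'n) one_step) a w) \<and>
    (\<forall>j\<in>{1..s}. \<alpha> j \<noteq> 0) \<and>
    (\<forall>a w. has_rk_form s (chebyshev_step s \<eta> :: (real ^ 'm, real ^ 'n) one_step) a w \<longrightarrow>
      (\<forall>i\<in>{1..s}. w i \<noteq> 0) \<and>
      (\<forall>u y Y p P. trajectory (chebyshev_step s \<eta>) N h f y0 u y Y \<longrightarrow>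
        (double_adjoint_costate s a w N h f \<Psi> u y Y p P \<and> (\<forall>k<N. P k 0 = p k)
           \<longleftrightarrow> recurrence_costate s (cheb_mu s \<eta>) (cheb_nu s \<eta>) \<alpha> N h f \<Psi> u y Y p P) \<and>
        (double_adjoint_stationarity s N f u Y P \<longleftrightarrow> recurrence_stationarity s N f u Y P)))"
proof -
  define \<mu> where "\<mu> = cheb_mu s \<eta>"
  define \<nu> where "\<nu> = (cheb_nu s \<eta>)(1 := 1)"
  define B where "B = green \<nu>"
  have s: "s \<ge> 2" "s \<ge> 1" and \<eta>: "\<eta> > 0" using assms by simp_all
  \<comment> \<open>\<open>cheb_nu s \<eta> 1 = 2\<close> by its formula; the value \<open>1\<close> makes the first stage an instance of the
    three-term recurrence.\<close>
  have \<nu>1: "\<nu> 1 = 1" by (simp add: \<nu>_def)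
  have \<nu>2: "cheb_nu s \<eta> i = \<nu> i" if "i \<ge> 2" for i using that by (simp add: \<nu>_def)
  have "is_alpha s \<nu> \<alpha>"
    using \<open>is_alpha s (cheb_nu s \<eta>) \<alpha>\<close> s unfolding is_alpha_def by (auto simp: \<nu>2)
  then have \<alpha>: "\<alpha> i = B s i" if "i \<in> {1..s}" for i
    using is_alpha_eq_green[of s \<nu> \<alpha> i] \<nu>1 s(1) that by (simp add: B_def)
  have \<mu>_pos: "\<mu> i > 0" for i
    unfolding \<mu>_def by (rule cheb_mu_pos[OF s(2) \<eta>])
  have B_pos: "B s i > 0" if "i \<in> {1..s}" for i
    using green_cheb_pos[OF s(2) \<eta>, of i] that by (simp add: B_def \<nu>_def)
  have form: "has_rk_form s (chebyshev_step s \<eta> :: (real ^ 'm, real ^ 'n) one_step)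
      (\<lambda>i j. \<mu> j * B (i - 1) j) (\<lambda>j. \<mu> j * B s j)"
    unfolding \<mu>_def B_def \<nu>_def by (rule chebyshev_has_rk_form[OF s(2)])
  have costate: "double_adjoint_costate s a w N h f \<Psi> u y Y p P \<and> (\<forall>k<N. P k 0 = p k)
      \<longleftrightarrow> recurrence_costate s (cheb_mu s \<eta>) (cheb_nu s \<eta>) \<alpha> N h f \<Psi> u y Y p P"
    if w: "\<And>j. j \<in> {1..s} \<Longrightarrow> w j = \<mu> j * B s j"
      and a: "\<And>i j. i \<in> {1..s} \<Longrightarrow> j \<in> {1..s} \<Longrightarrow> a i j = \<mu> j * B (i - 1) j"
    for a w u y Y p P
  proof -
    define G where "G k j = grad_y_H f (u k (j - 1)) (Y k (j - 1)) (P k j)" for k j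
    define Adj where "Adj k \<longleftrightarrow>
        p k = p (Suc k) + h *\<^sub>R (\<Sum>i=1..s. w i *\<^sub>R G k i) \<and>
        (\<forall>i\<in>{1..s}. P k i = p (Suc k) + h *\<^sub>R (\<Sum>j=1..s. (w j / w i * a j i) *\<^sub>R G k j))" for k
    define Rec where "Rec k \<longleftrightarrow> P k s = p (Suc k) \<and>
        P k (s - 1) = P k s + (\<mu> s / cheb_nu s \<eta> s * h) *\<^sub>R G k s \<and>
        (\<forall>j\<in>{2..s-1}. P k (s - j) =
            (\<mu> (s - j + 1) * \<alpha> (s - j + 1) / \<alpha> (s - j) * h) *\<^sub>R G k (s - j + 1)
          + (cheb_nu s \<eta> (s - j + 1) * \<alpha> (s - j + 1) / \<alpha> (s - j)) *\<^sub>R P k (s - j + 1)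
          + ((1 - cheb_nu s \<eta> (s - j + 2)) * \<alpha> (s - j + 2) / \<alpha> (s - j))
              *\<^sub>R P k (s - j + 2)) \<and>
        P k 0 = (\<mu> 1 * \<alpha> 1 * h) *\<^sub>R G k 1
          + \<alpha> 1 *\<^sub>R P k 1 + ((1 - cheb_nu s \<eta> 2) * \<alpha> 2) *\<^sub>R P k 2 \<and>
        p k = P k 0" for k
    have step: "Adj k \<and> P k 0 = p k \<longleftrightarrow> Rec k" for k
    proof -
      define E where "E i \<longleftrightarrow> B s i *\<^sub>R P k i = (\<mu> (Suc i) * B s (Suc i) * h) *\<^sub>R G k (Suc i)
        + (\<nu> (Suc i) * B s (Suc i)) *\<^sub>R P k (Suc i)
        + ((1 - \<nu> (Suc (Suc i))) * B s (Suc (Suc i))) *\<^sub>R P k (Suc (Suc i))" for i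
      have sum_w: "(\<Sum>i=1..s. w i *\<^sub>R G k i) = (\<Sum>j=1..s. (\<mu> j * B s j) *\<^sub>R G k j)"
        by (intro sum.cong refl) (simp add: w)
      have sum_a: "(\<Sum>j=1..s. (w j / w i * a j i) *\<^sub>R G k j)
          = (\<Sum>j=1..s. (\<mu> j * B s j / (\<mu> i * B s i) * (\<mu> i * B (j - 1) i)) *\<^sub>R G k j)"
        if "i \<in> {1..s}" for i
        using that by (intro sum.cong refl) (simp add: w a)
      have "Adj k \<and> P k 0 = p k \<longleftrightarrow>
          (P k 0 = p (Suc k) + h *\<^sub>R (\<Sum>j=1..s. (\<mu> j * B s j) *\<^sub>R G k j) \<and>
          (\<forall>i\<in>{1..s}. P k i = p (Suc k)
            + h *\<^sub>R (\<Sum>j=1..s. (\<mu> j * B s j / (\<mu> i * B s i) * (\<mu> i * B (j - 1) i)) *\<^sub>R G k j)))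
          \<and> P k 0 = p k"
        unfolding Adj_def sum_w using sum_a by auto
      also have "\<dots> \<longleftrightarrow> (P k s = p (Suc k) \<and> (\<forall>i<s. E i)) \<and> P k 0 = p k"
        unfolding E_def B_def
        by (subst adjoint_step_iff[of \<nu> s \<mu>])
          (use \<nu>1 \<mu>_pos B_pos in \<open>auto simp: B_def less_imp_neq[symmetric] simp del: green.simps\<close>)
      \<comment> \<open>At \<open>s - 1\<close> the second-order term vanishes because \<open>B s (s + 1) = 0\<close>, and at \<open>0\<close> the
        normalisation is \<open>B s 0 = 1\<close>; this is why these two lines of the recurrence have their
        own form. The other lines are \<open>E i\<close> divided by \<open>\<alpha> i\<close>.\<close>
      also have "(\<forall>i<s. E i) \<longleftrightarrow> E (s - 1) \<and> (\<forall>j\<in>{2..s-1}. E (s - j)) \<and> E 0"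
      proof
        assume *: "E (s - 1) \<and> (\<forall>j\<in>{2..s-1}. E (s - j)) \<and> E 0"
        show "\<forall>i<s. E i"
        proof (intro allI impI)
          fix i assume "i < s"
          then consider "i = s - 1" | "i = 0" | "s - i \<in> {2..s-1}" "s - (s - i) = i"
            by force
          then show "E i" using * by cases metis+
        qed
      qed (use s in auto)
      also have "E 0 \<longleftrightarrow> P k 0 = (\<mu> 1 * \<alpha> 1 * h) *\<^sub>R G k 1
          + \<alpha> 1 *\<^sub>R P k 1 + ((1 - cheb_nu s \<eta> 2) * \<alpha> 2) *\<^sub>R P k 2"
        using s \<nu>1 \<alpha>[of 1] \<alpha>[of 2] \<nu>2[of 2] green_column_0[of \<nu> s]
        by (simp add: E_def B_def numeral_2_eq_2 del: green.simps)
      also have "E (s - 1) \<longleftrightarrow> P k (s - 1) = P k s + (\<mu> s / cheb_nu s \<eta> s * h) *\<^sub>R G k s"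
      proof -
        have n: "\<nu> s = B s (s - 1)"
          using \<alpha>[of "s - 1"] \<open>is_alpha s \<nu> \<alpha>\<close> s by (simp add: is_alpha_def)
        have "\<nu> s \<noteq> 0" unfolding n using B_pos[of "s - 1"] s by (simp add: less_imp_neq[symmetric])
        then have "P k (s - 1) = P k s + (\<mu> s / \<nu> s * h) *\<^sub>R G k s \<longleftrightarrow>
            \<nu> s *\<^sub>R P k (s - 1) = \<nu> s *\<^sub>R (P k s + (\<mu> s / \<nu> s * h) *\<^sub>R G k s)"
          by (subst real_vector.scale_cancel_left) auto
        moreover have "Suc (s - 1) = s" "B s (Suc s) = 0" "B s s = 1"
          using s by (simp_all add: B_def green_diagonal green_above_diagonal del: green.simps)
        ultimately show ?thesis
          using \<open>\<nu> s \<noteq> 0\<close> n[symmetric] \<nu>2[OF s(1)]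
          by (simp add: E_def scaleR_add_right add.commute)
      qed
      also have "(\<forall>j\<in>{2..s-1}. E (s - j)) \<longleftrightarrow> (\<forall>j\<in>{2..s-1}. P k (s - j) =
            (\<mu> (s - j + 1) * \<alpha> (s - j + 1) / \<alpha> (s - j) * h) *\<^sub>R G k (s - j + 1)
          + (cheb_nu s \<eta> (s - j + 1) * \<alpha> (s - j + 1) / \<alpha> (s - j)) *\<^sub>R P k (s - j + 1)
          + ((1 - cheb_nu s \<eta> (s - j + 2)) * \<alpha> (s - j + 2) / \<alpha> (s - j)) *\<^sub>R P k (s - j + 2))"
      proof (intro ball_cong refl)
        fix j assume j: "j \<in> {2..s-1}"
        define i where "i = s - j"
        have i: "1 \<le> i" "Suc (Suc i) \<le> s" using j by (auto simp: i_def)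
        have nz: "\<alpha> i \<noteq> 0" using \<alpha>[of i] B_pos[of i] i by simp
        let ?r = "(\<mu> (Suc i) * \<alpha> (Suc i) / \<alpha> i * h) *\<^sub>R G k (Suc i)
          + (\<nu> (Suc i) * \<alpha> (Suc i) / \<alpha> i) *\<^sub>R P k (Suc i)
          + ((1 - \<nu> (Suc (Suc i))) * \<alpha> (Suc (Suc i)) / \<alpha> i) *\<^sub>R P k (Suc (Suc i))"
        have "P k i = ?r \<longleftrightarrow> \<alpha> i *\<^sub>R P k i = \<alpha> i *\<^sub>R ?r"
          using nz by (subst real_vector.scale_cancel_left) auto
        also have "\<dots> \<longleftrightarrow> E i"
          unfolding E_def using nz i \<alpha>[of i] \<alpha>[of "Suc i"] \<alpha>[of "Suc (Suc i)"]
          by (simp add: scaleR_add_right mult_ac)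
        finally have "E i \<longleftrightarrow> P k i = ?r" ..
        then show "E (s - j) \<longleftrightarrow> P k (s - j) =
            (\<mu> (s - j + 1) * \<alpha> (s - j + 1) / \<alpha> (s - j) * h) *\<^sub>R G k (s - j + 1)
          + (cheb_nu s \<eta> (s - j + 1) * \<alpha> (s - j + 1) / \<alpha> (s - j)) *\<^sub>R P k (s - j + 1)
          + ((1 - cheb_nu s \<eta> (s - j + 2)) * \<alpha> (s - j + 2) / \<alpha> (s - j)) *\<^sub>R P k (s - j + 2)"
          using i \<nu>2[of "Suc i"] \<nu>2[of "Suc (Suc i)"] by (simp add: i_def[symmetric])
      qed
      finally show ?thesis unfolding Rec_def by auto
    qed
    have "double_adjoint_costate s a w N h f \<Psi> u y Y p P
        \<longleftrightarrow> p N = gradient \<Psi> (y N) \<and> (\<forall>k<N. Adj k)"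
      by (simp add: double_adjoint_costate_def Adj_def G_def)
    moreover have "recurrence_costate s (cheb_mu s \<eta>) (cheb_nu s \<eta>) \<alpha> N h f \<Psi> u y Y p P
        \<longleftrightarrow> p N = gradient \<Psi> (y N) \<and> (\<forall>k<N. Rec k)"
      by (simp add: recurrence_costate_def Rec_def G_def \<mu>_def)
    ultimately show ?thesis using step by blast
  qed
  have stationarity: "double_adjoint_stationarity s N f u Y P \<longleftrightarrow> recurrence_stationarity s N f u Y P"
    for u Y P
  proof -
    have reindex: "(\<forall>i\<in>{1..s}. Q (i - 1) i) \<longleftrightarrow> (\<forall>j\<in>{1..s}. Q (s - j) (s - j + 1))"
      for Q :: "nat \<Rightarrow> nat \<Rightarrow> bool"
    proof (intro iffI ballI)
      fix j assume "\<forall>i\<in>{1..s}. Q (i - 1) i" "j \<in> {1..s}"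
      then show "Q (s - j) (s - j + 1)" by (auto dest!: bspec[of _ _ "s - j + 1"])
    next
      fix i assume "\<forall>j\<in>{1..s}. Q (s - j) (s - j + 1)" "i \<in> {1..s}"
      moreover from this have "s - (s - i + 1) = i - 1" "i - 1 + 1 = i" "s - i + 1 \<in> {1..s}"
        by auto
      ultimately show "Q (i - 1) i" by metis
    qed
    have "(\<forall>i\<in>{1..s}. grad_u_H f (u k (i - 1)) (Y k (i - 1)) (P k i) = 0)
        \<longleftrightarrow> (\<forall>j\<in>{1..s}. grad_u_H f (u k (s - j)) (Y k (s - j)) (P k (s - j + 1)) = 0)" for k
      by (rule reindex)
    then show ?thesis
      unfolding double_adjoint_stationarity_def recurrence_stationarity_def by (simp only:)
  qed
  show ?thesis
  proof (intro conjI allI impI)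
    show "\<exists>a w. has_rk_form s (chebyshev_step s \<eta> :: (real ^ 'm, real ^ 'n) one_step) a w"
      using form by blast
    show "\<forall>j\<in>{1..s}. \<alpha> j \<noteq> 0" using \<alpha> B_pos by (metis less_irrefl)
  next
    fix a w
    assume aw: "has_rk_form s (chebyshev_step s \<eta> :: (real ^ 'm, real ^ 'n) one_step) a w"
    have w: "w j = \<mu> j * B s j" if "j \<in> {1..s}" for j
      using has_rk_form_unique(1)[OF aw form that] .
    have a: "a i j = \<mu> j * B (i - 1) j" if "i \<in> {1..s}" "j \<in> {1..s}" for i j
      using has_rk_form_unique(2)[OF aw form that(2,1)] .
    show "\<forall>i\<in>{1..s}. w i \<noteq> 0" using w \<mu>_pos B_pos by (metis less_irrefl mult_pos_pos)
    fix u y Y p P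
    show "double_adjoint_costate s a w N h f \<Psi> u y Y p P \<and> (\<forall>k<N. P k 0 = p k)
        \<longleftrightarrow> recurrence_costate s (cheb_mu s \<eta>) (cheb_nu s \<eta>) \<alpha> N h f \<Psi> u y Y p P"
      by (rule costate[OF w a])
    show "double_adjoint_stationarity s N f u Y P \<longleftrightarrow> recurrence_stationarity s N f u Y P"
      by (rule stationarity)
  qed
qed

end
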